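(* Every compact Hausdorff space $X$ is Stäckel-compact.
   Context: Work in ZFC. A Hausdorff topological space $X$ is Stäckel-compact if there is a linear (total) order $\prec$ on the set $X$ such that every non-empty closed subset of $X$ has a $\prec$-least and a $\prec$-greatest element; $\prec$ is not assumed to be related to the topology of $X$ in any other way. *)

theory Defs
  imports "HOL-Analysis.Analysis"
begin

(* r is the reflexive form of the strict order in the usual definition; nothing relates it
   to the topology beyond the condition on closed sets. *)
definition Stackel_compact :: "'a topology \<Rightarrow> bool" where
  "Stackel_compact X \<longleftrightarrow>
     Hausdorff_space X \<and>
     (\<exists>r. linear_order_on (topspace X) r \<and>
          (\<forall>C. closedin X C \<and> C \<noteq> {} \<longrightarrow>
               (\<exists>m\<in>C. \<forall>x\<in>C. (m, x) \<in> r) \<and>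
               (\<exists>M\<in>C. \<forall>x\<in>C. (x, M) \<in> r)))"

end

theory Submission
  imports Defs
begin

text \<open>
  By Urysohn's lemma the continuous real functions on a compact Hausdorff space \<open>X\<close> separate its
  points. Well-order the set of these functions and compare two points lexicographically: the one
  with the smaller value at the first function where they differ comes first. This is a linear order
  on \<open>X\<close> (\<open>linear_order_on_lex_le\<close>), namely the one induced by the evaluation map of \<open>X\<close> into a power
  of the reals.

  A non-empty closed set \<open>C\<close> has a least element because lexicographic minimization can be carried
  out by transfinite recursion (\<open>closed_has_lex_least\<close>). Among the points of \<open>C\<close> that survived
  the minimization of all earlier functions, keep those where the current function is smallest.
  The surviving sets form a decreasing chain of non-empty closed sets: at successor steps because a
  continuous function attains its minimum on a compact set, at limit steps because a chain of
  non-empty closed sets in a compact space has non-empty intersection. A point surviving all steps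
  is least in \<open>C\<close>. Replacing every function by its negative reverses the order, so a greatest
  element is obtained from the same lemma.
\<close>

section \<open>Lexicographic comparison of points\<close>

text \<open>
  The lexicographic comparison of the families \<open>(f i x)\<close> and \<open>(f i y)\<close>, with \<open>i\<close> ranging over \<open>I\<close>.
  Here \<open>R\<close> is the strict order of the indices, with \<open>(j, i) \<in> R\<close> meaning that \<open>j\<close> precedes \<open>i\<close>.
\<close>

definition lex_le :: "('i \<times> 'i) set \<Rightarrow> 'i set \<Rightarrow> ('i \<Rightarrow> 'a \<Rightarrow> real) \<Rightarrow> 'a \<Rightarrow> 'a \<Rightarrow> bool" where
  "lex_le R I f x y \<longleftrightarrow>
     (\<forall>i\<in>I. f i x = f i y) \<or>
     (\<exists>i\<in>I. f i x < f i y \<and> (\<forall>j\<in>I. (j, i) \<in> R \<longrightarrow> f j x = f j y))"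

lemma lex_le_refl: "lex_le R I f x x"
  by (simp add: lex_le_def)

lemma lex_le_uminus: "lex_le R I (\<lambda>i x. - f i x) x y \<longleftrightarrow> lex_le R I f y x"
  unfolding lex_le_def by (auto simp: eq_commute)

lemma lex_le_antisym:
  assumes tot: "total_on I R" and xy: "lex_le R I f x y" and yx: "lex_le R I f y x"
    and i: "i \<in> I"
  shows "f i x = f i y"
proof (rule ccontr)
  assume ne: "f i x \<noteq> f i y"
  obtain j where j: "j \<in> I" "f j x < f j y" "\<forall>k\<in>I. (k, j) \<in> R \<longrightarrow> f k x = f k y"
    using xy ne i unfolding lex_le_def by blast
  obtain k where k: "k \<in> I" "f k y < f k x" "\<forall>j\<in>I. (j, k) \<in> R \<longrightarrow> f j y = f j x"
    using yx ne[symmetric] i unfolding lex_le_def by blast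
  have "j = k \<or> (j, k) \<in> R \<or> (k, j) \<in> R"
    using tot j(1) k(1) unfolding total_on_def by blast
  then show False
    using j k by force
qed

lemma lex_le_trans:
  assumes tot: "total_on I R" and tr: "trans R"
    and xy: "lex_le R I f x y" and yz: "lex_le R I f y z"
  shows "lex_le R I f x z"
proof -
  consider (xy) "\<forall>i\<in>I. f i x = f i y" | (yz) "\<forall>i\<in>I. f i y = f i z"
    | (neither) "\<not> (\<forall>i\<in>I. f i x = f i y)" "\<not> (\<forall>i\<in>I. f i y = f i z)"
    by blast
  then show ?thesis
  proof cases
    case xy
    then have "lex_le R I f x z \<longleftrightarrow> lex_le R I f y z"
      unfolding lex_le_def by simp
    with yz show ?thesis by simp
  next
    case yz
    then have "lex_le R I f x z \<longleftrightarrow> lex_le R I f x y"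
      unfolding lex_le_def by simp
    with xy show ?thesis by simp
  next
    case neither
    then obtain j k
      where j: "j \<in> I" "f j x < f j y" "\<forall>l\<in>I. (l, j) \<in> R \<longrightarrow> f l x = f l y"
        and k: "k \<in> I" "f k y < f k z" "\<forall>l\<in>I. (l, k) \<in> R \<longrightarrow> f l y = f l z"
      using xy yz unfolding lex_le_def by blast
    consider "j = k" | "(j, k) \<in> R" | "(k, j) \<in> R"
      using tot j(1) k(1) unfolding total_on_def by blast
    then show ?thesis
    proof cases
      case 1
      then have "f j x < f j z" "\<forall>l\<in>I. (l, j) \<in> R \<longrightarrow> f l x = f l z"
        using j k by auto
      then show ?thesis
        using j(1) unfolding lex_le_def by blast
    next
      case 2
      then have "f j x < f j z" "\<forall>l\<in>I. (l, j) \<in> R \<longrightarrow> f l x = f l z"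
        using j k transD[OF tr _ 2] by auto
      then show ?thesis
        using j(1) unfolding lex_le_def by blast
    next
      case 3
      then have "f k x < f k z" "\<forall>l\<in>I. (l, k) \<in> R \<longrightarrow> f l x = f l z"
        using j k transD[OF tr _ 3] by auto
      then show ?thesis
        using k(1) unfolding lex_le_def by blast
    qed
  qed
qed

lemma wf_first_difference:
  assumes wf: "wf R" and "i \<in> I" "f i x \<noteq> f i y"
  obtains j where "j \<in> I" "f j x \<noteq> f j y" "\<forall>k\<in>I. (k, j) \<in> R \<longrightarrow> f k x = f k y"
proof -
  have "i \<in> {i \<in> I. f i x \<noteq> f i y}"
    using assms by simp
  then obtain j where "j \<in> {i \<in> I. f i x \<noteq> f i y}"
    "\<And>k. (k, j) \<in> R \<Longrightarrow> k \<notin> {i \<in> I. f i x \<noteq> f i y}"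
    by (rule wfE_min[OF wf]) blast
  then show thesis
    by (intro that[of j]) auto
qed

lemma lex_le_total:
  assumes wf: "wf R"
  shows "lex_le R I f x y \<or> lex_le R I f y x"
proof (cases "\<forall>i\<in>I. f i x = f i y")
  case True
  then show ?thesis by (simp add: lex_le_def)
next
  case False
  then obtain i where "i \<in> I" "f i x \<noteq> f i y" by blast
  from wf_first_difference[where f = f, OF wf this] obtain j
    where j: "j \<in> I" "f j x \<noteq> f j y" "\<forall>k\<in>I. (k, j) \<in> R \<longrightarrow> f k x = f k y" .
  from j(2) consider "f j x < f j y" | "f j y < f j x" by linarith
  then show ?thesis
  proof cases
    case 1
    then have "lex_le R I f x y"
      using j(1,3) unfolding lex_le_def by blast
    then show ?thesis ..
  next
    case 2
    moreover have "\<forall>k\<in>I. (k, j) \<in> R \<longrightarrow> f k y = f k x"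
      using j(3) by simp
    ultimately have "lex_le R I f y x"
      using j(1) unfolding lex_le_def by blast
    then show ?thesis ..
  qed
qed

lemma linear_order_on_lex_le:
  assumes tot: "total_on I R" and tr: "trans R" and wf: "wf R"
    and sep: "\<And>x y. \<lbrakk>x \<in> A; y \<in> A; \<forall>i\<in>I. f i x = f i y\<rbrakk> \<Longrightarrow> x = y"
  shows "linear_order_on A {(x, y). x \<in> A \<and> y \<in> A \<and> lex_le R I f x y}" (is "linear_order_on A ?L")
proof -
  have "?L \<subseteq> A \<times> A"
    by auto
  moreover have "refl_on A ?L"
    by (auto intro!: refl_onI lex_le_refl)
  moreover have "antisym ?L"
  proof (rule antisymI)
    fix x y assume "(x, y) \<in> ?L" "(y, x) \<in> ?L"
    then have xy: "x \<in> A" "y \<in> A" "lex_le R I f x y" "lex_le R I f y x"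
      by simp_all
    then have "\<forall>i\<in>I. f i x = f i y"
      by (intro ballI lex_le_antisym[OF tot, where f = f])
    with xy(1,2) show "x = y"
      by (rule sep)
  qed
  moreover have "trans ?L"
    by (rule transI) (auto intro: lex_le_trans[OF tot tr])
  moreover have "total_on A ?L"
    using lex_le_total[OF wf, of I f] by (auto simp: total_on_def)
  ultimately show ?thesis
    unfolding linear_order_on_def partial_order_on_def preorder_on_def by (intro conjI)
qed

section \<open>Lexicographic minima of closed sets\<close>

lemma compact_space_continuous_attains_inf:
  assumes X: "compact_space X" and D: "closedin X D" "D \<noteq> {}"
    and g: "continuous_map X euclideanreal g"
  obtains m where "m \<in> D" "\<forall>y\<in>D. g m \<le> g y"
proof -
  have "compactin euclideanreal (g ` D)"
    using image_compactin closedin_compact_space[OF X D(1)] g by blast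
  then have "compact (g ` D)" by simp
  then show thesis
    using compact_attains_inf[of "g ` D"] D(2) that by blast
qed

text \<open>
  The recursion is replaced by the explicit description of the surviving sets: \<open>K i\<close> consists of the
  points \<open>x\<close> of \<open>C\<close> such that for every index \<open>j\<close> up to and including \<open>i\<close>, the value \<open>f j x\<close> is minimal
  among the points of \<open>C\<close> that agree with \<open>x\<close> at all indices before \<open>j\<close>. That each \<open>K i\<close> is closed
  and non-empty follows by well-founded induction on \<open>i\<close>.
\<close>

lemma closed_has_lex_least:
  assumes X: "compact_space X" and f: "\<And>i. i \<in> I \<Longrightarrow> continuous_map X euclideanreal (f i)"
    and tot: "total_on I R" and tr: "trans R" and wf: "wf R"
    and C: "closedin X C" "C \<noteq> {}"
  shows "\<exists>m\<in>C. \<forall>x\<in>C. lex_le R I f m x"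
proof -
  define agree where "agree i x y \<longleftrightarrow> (\<forall>h\<in>I. (h, i) \<in> R \<longrightarrow> f h x = f h y)" for i x y
  define K where
    "K i = {x \<in> C. \<forall>j\<in>I. j = i \<or> (j, i) \<in> R \<longrightarrow> (\<forall>y\<in>C. agree j x y \<longrightarrow> f j x \<le> f j y)}" for i
  have K_sub: "K i \<subseteq> C" for i
    unfolding K_def by blast
  have K_mono: "K i \<subseteq> K j" if "(j, i) \<in> R" for i j
    using transD[OF tr _ that] that unfolding K_def by blast
  have K_min: "f i x \<le> f i y" if "x \<in> K i" "i \<in> I" "y \<in> C" "agree i x y" for i x y
    using that unfolding K_def by blast
  have K_const: "f i x = f i y" if "i \<in> I" "x \<in> K i" "y \<in> K i" for i x y
    using wf that
  proof (induction i rule: wf_induct_rule)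
    case (less i)
    then have "agree i x y" "agree i y x"
      unfolding agree_def using K_mono by (blast, metis subsetD)
    then show ?case
      using K_min less.prems K_sub by (metis antisym subsetD)
  qed
  \<comment> \<open>This serves both the limit steps and the final intersection over all indices. The factor \<open>C\<close>
    covers the empty index set, for which the intersection of the \<open>K j\<close> would be the whole type.\<close>
  have inter: "C \<inter> \<Inter>(K ` J) \<noteq> {}"
    if J: "J \<subseteq> I" and K: "\<And>j. j \<in> J \<Longrightarrow> closedin X (K j) \<and> K j \<noteq> {}" for J
  proof (cases "J = {}")
    case True
    then show ?thesis using C by simp
  next
    case False
    have "\<Inter>(K ` J) \<noteq> {}"
    proof -
      have chain: "\<exists>k\<in>J. K k \<subseteq> \<Inter>(K ` F)" if "finite F" "F \<noteq> {}" "F \<subseteq> J" for F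
        using that
      proof (induction F rule: finite_ne_induct)
        case (singleton j)
        then show ?case by auto
      next
        case (insert j F)
        then obtain k where k: "k \<in> J" "K k \<subseteq> \<Inter>(K ` F)" by blast
        have "j = k \<or> (j, k) \<in> R \<or> (k, j) \<in> R"
          using tot k(1) insert.prems J unfolding total_on_def by blast
        then have "K k \<subseteq> K j \<or> K j \<subseteq> K k"
          using K_mono by blast
        with k insert.prems show ?case by auto
      qed
      have "\<Inter>\<F> \<noteq> {}" if fin: "finite \<F>" "\<F> \<subseteq> K ` J" for \<F>
      proof (cases "\<F> = {}")
        case False
        obtain F where F: "F \<subseteq> J" "finite F" "\<F> = K ` F"
          using fin finite_subset_image by metis
        then obtain k where "k \<in> J" "K k \<subseteq> \<Inter>\<F>"
          using chain[of F] False by blast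
        then show ?thesis using K by blast
      qed simp
      moreover have "\<forall>A\<in>K ` J. closedin X A"
        using K by blast
      ultimately show ?thesis
        using X[unfolded compact_space_fip, rule_format, of "K ` J"] by blast
    qed
    with False K_sub show ?thesis by blast
  qed
  have K: "closedin X (K i) \<and> K i \<noteq> {}" if "i \<in> I" for i
    using wf that
  proof (induction i rule: wf_induct_rule)
    case (less i)
    define J where "J = {j \<in> I. (j, i) \<in> R}"
    \<comment> \<open>\<open>D\<close> is the set of points that survived before stage \<open>i\<close>. Its points agree at all indices before \<open>i\<close>,
      and \<open>D\<close> contains every point of \<open>C\<close> that agrees there with a point of \<open>D\<close>. Hence \<open>K i\<close> is the
      set of minimum points of \<open>f i\<close> on \<open>D\<close>.\<close>
    define D where "D = C \<inter> \<Inter>(K ` J)"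
    have KJ: "closedin X (K j) \<and> K j \<noteq> {}" if "j \<in> J" for j
      using less that unfolding J_def by blast
    have "J \<subseteq> I"
      unfolding J_def by blast
    then have D_ne: "D \<noteq> {}"
      unfolding D_def by (rule inter) (rule KJ)
    have D_closed: "closedin X D"
    proof (cases "J = {}")
      case True
      then show ?thesis using C by (simp add: D_def)
    next
      case False
      then show ?thesis
        unfolding D_def using KJ C by (intro closedin_Int closedin_Inter) auto
    qed
    obtain m where m: "m \<in> D" "\<forall>y\<in>D. f i m \<le> f i y"
      using compact_space_continuous_attains_inf[OF X D_closed D_ne f[OF less.prems]] .
    have D_agree: "agree i x y" if "x \<in> D" "y \<in> D" for x y
      using that K_const unfolding agree_def D_def J_def by blast
    have agree_D: "y \<in> D" if x: "x \<in> D" and y: "y \<in> C" and xy: "agree i x y" for x y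
    proof -
      have "y \<in> K j" if j: "j \<in> I" "(j, i) \<in> R" for j
      proof -
        have xj: "x \<in> K j"
          using x j unfolding D_def J_def by blast
        have "f l y \<le> f l z" if l: "l \<in> I" "l = j \<or> (l, j) \<in> R" and z: "z \<in> C" "agree l y z" for l z
        proof -
          have li: "(l, i) \<in> R"
            using l j tr by (meson transD)
          then have "agree l x z"
            using z(2) xy tr unfolding agree_def by (metis transD)
          then have "f l x \<le> f l z"
            using xj l z unfolding K_def by blast
          then show ?thesis
            using xy l li unfolding agree_def by simp
        qed
        then show ?thesis
          using y unfolding K_def by blast
      qed
      then show ?thesis
        using y unfolding D_def J_def by blast
    qed
    have K_eq: "K i = {x \<in> D. f i x \<le> f i m}"
    proof (intro equalityI subsetI)
      fix x assume x: "x \<in> K i"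
      then have xD: "x \<in> D"
        using K_mono K_sub unfolding D_def J_def by blast
      then have "f i x \<le> f i m"
        using K_min[OF x less.prems] D_agree m(1) by (simp add: D_def)
      with xD show "x \<in> {x \<in> D. f i x \<le> f i m}" by simp
    next
      fix x assume "x \<in> {x \<in> D. f i x \<le> f i m}"
      then have x: "x \<in> D" "f i x \<le> f i m" by simp_all
      have "f j x \<le> f j y" if j: "j \<in> I" "j = i \<or> (j, i) \<in> R" and y: "y \<in> C" "agree j x y" for j y
        using j(2)
      proof
        assume "j = i"
        then show ?thesis
          using agree_D[OF x(1) y(1)] y(2) m(2) x(2) by force
      next
        assume "(j, i) \<in> R"
        then have "x \<in> K j"
          using x(1) j(1) unfolding D_def J_def by blast
        then show ?thesis
          using K_min j(1) y by blast
      qed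
      then show "x \<in> K i"
        using x(1) unfolding K_def D_def by blast
    qed
    have "closedin X {x \<in> topspace X. f i x \<in> {..f i m}}"
      using closedin_continuous_map_preimage[OF f[OF less.prems], of "{..f i m}"] by simp
    then have "closedin X (D \<inter> {x \<in> topspace X. f i x \<in> {..f i m}})"
      using D_closed by (rule closedin_Int[rotated])
    moreover have "D \<inter> {x \<in> topspace X. f i x \<in> {..f i m}} = K i"
      using closedin_subset[OF D_closed] unfolding K_eq by auto
    ultimately show ?case
      using m(1) K_eq by auto
  qed
  obtain m where m: "m \<in> C" "\<And>i. i \<in> I \<Longrightarrow> m \<in> K i"
    using inter[OF subset_refl K] by blast
  have "lex_le R I f m x" if x: "x \<in> C" for x
  proof (cases "\<forall>i\<in>I. f i m = f i x")
    case False
    then obtain i where "i \<in> I" "f i m \<noteq> f i x" by blast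
    from wf_first_difference[where f = f, OF wf this] obtain j
      where j: "j \<in> I" "f j m \<noteq> f j x" "\<forall>k\<in>I. (k, j) \<in> R \<longrightarrow> f k m = f k x" .
    then have "f j m \<le> f j x"
      using K_min[OF m(2) _ x] unfolding agree_def by blast
    with j show ?thesis
      unfolding lex_le_def by force
  qed (simp add: lex_le_def)
  with m(1) show ?thesis by blast
qed

section \<open>Compact Hausdorff spaces\<close>

lemma compact_Hausdorff_continuous_separates:
  assumes "compact_space X" "Hausdorff_space X" "x \<in> topspace X" "y \<in> topspace X" "x \<noteq> y"
  obtains g where "continuous_map X euclideanreal g" "g x \<noteq> g y"
proof -
  have "normal_space X"
    using assms compact_Hausdorff_or_regular_imp_normal_space by blast
  moreover have "closedin X {x}" "closedin X {y}"
    using assms by (simp_all add: closedin_Hausdorff_sing_eq)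
  moreover have "disjnt {x} {y}"
    using assms by simp
  ultimately obtain g where "continuous_map X euclideanreal g" "g ` {x} \<subseteq> {0}" "g ` {y} \<subseteq> {1}"
    by (rule Urysohn_lemma_alt)
  then show thesis
    using that[of g] by auto
qed

theorem proposition3p2:
  fixes X :: "'a topology"
  assumes "compact_space X" and "Hausdorff_space X"
  shows "Stackel_compact X"
proof -
  define I where "I = {g :: 'a \<Rightarrow> real. continuous_map X euclideanreal g}"
  obtain W :: "('a \<Rightarrow> real) rel" where W: "well_order_on I W"
    using well_order_on by blast
  define R where "R = W - Id"
  have wf: "wf R" and tr: "trans R" and tot: "total_on I R"
    using W unfolding R_def order_on_defs by (simp_all add: trans_diff_Id)
  \<comment> \<open>The functions index themselves, so the family is the identity.\<close>
  define L where "L = {(x, y). x \<in> topspace X \<and> y \<in> topspace X \<and> lex_le R I (\<lambda>g. g) x y}"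
  have "x = y" if "x \<in> topspace X" "y \<in> topspace X" "\<forall>g\<in>I. g x = g y" for x y
  proof (rule ccontr)
    assume "x \<noteq> y"
    with compact_Hausdorff_continuous_separates[OF assms that(1,2)]
    obtain g where "continuous_map X euclideanreal g" "g x \<noteq> g y" .
    with that(3) show False
      unfolding I_def by blast
  qed
  then have "linear_order_on (topspace X) L"
    unfolding L_def by (rule linear_order_on_lex_le[OF tot tr wf])
  moreover have "(\<exists>m\<in>C. \<forall>x\<in>C. (m, x) \<in> L) \<and> (\<exists>M\<in>C. \<forall>x\<in>C. (x, M) \<in> L)"
    if C: "closedin X C" "C \<noteq> {}" for C
  proof -
    have "\<exists>m\<in>C. \<forall>x\<in>C. lex_le R I (\<lambda>g. g) m x"
      by (rule closed_has_lex_least[OF assms(1) _ tot tr wf C]) (simp add: I_def)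
    moreover have "\<exists>M\<in>C. \<forall>x\<in>C. lex_le R I (\<lambda>g x. - g x) M x"
      by (rule closed_has_lex_least[OF assms(1) _ tot tr wf C])
        (simp add: I_def continuous_map_minus)
    ultimately show ?thesis
      using closedin_subset[OF C(1)] unfolding L_def lex_le_uminus by blast
  qed
  ultimately show ?thesis
    unfolding Stackel_compact_def using assms(2) by blast
qed

end
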